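(* Consider testing $m$ hypotheses with presorted scores $T_1\ge T_2\ge\dots\ge T_m$ post hoc via closed testing at level $\alpha$, using a local test of the form $$t_\alpha(J)=\mathbf 1\Big\{\sum_{i\in J}h(T_i)\le C(|J|,\alpha)\Big\},$$ where $h$ is a monotonically increasing function. For a set $S\subseteq[m]$, Algorithm 1 (written out in the context) returns the simultaneous false discovery bound $$\overline e_\alpha(S)=\max\{|I|:I\subseteq S,\ \overline t_\alpha(I)=0\},$$ with at most $O(m)$ computation.
   Context: There are $m$ hypotheses $H_1,\dots,H_m$, $[m]=\{1,\dots,m\}$, and each $H_i$ comes with a real-valued score $T_i$ (for example a $p$-value), small values being evidence against $H_i$. A local test at level $\alpha$ assigns to each $J\subseteq[m]$ a value $t_\alpha(J)\in\{0,1\}$, where $1$ means that the intersection hypothesis $H_J=\bigcap_{i\in J}H_i$ is rejected; $H_\emptyset$ is always true and never rejected, $t_\alpha(\emptyset)=0$. $C(s,\alpha)$ is a critical value depending only on the cardinality $s$ and on $\alpha$. Closed testing: $\overline t_\alpha(I)=\mathbf 1\{t_\alpha(J)=1\text{ for all }J\text{ with }I\subseteq J\subseteq[m]\}$. Thus $\overline e_\alpha(S)$ is the size of the largest subset of $S$ not rejected by closed testing. Algorithm 1. Input: sorted scores $T_1\ge\dots\ge T_m$; the functions $h$ and $C$; the level $\alpha$; the set $S=\{i_1,\dots,i_s\}$ and its complement $S^c=\{j_1,\dots,j_{m-s}\}$, with $i_1<\dots<i_s$ and $j_1<\dots<j_{m-s}$. Initialization: $u_d=h(T_{i_d})$ for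 $1\le d\le s$; $v_d=h(T_{j_d})$ for $1\le d\le m-s$; $v_0=\max(u_1,v_1)$; $u_{s+t}$ and $v_{m-s+t}$ are set equal to $\min(u_s,v_{m-s})-1$ for all $t\ge1$ (in this maximum and this minimum, terms belonging to an empty $S$ or empty $S^c$ are omitted); $k\leftarrow1$; $b\leftarrow-1$; $Q\leftarrow0$. For $a=1,\dots,m$ do the following two steps. Step 1: if $u_{k+b+1}\ge v_{a-k-b}$ or $a=1$, set $Q\leftarrow Q+u_{k+b+1}$ and then $b\leftarrow b+1$; otherwise set $Q\leftarrow Q+v_{a-k-b}$. Step 2: while $k\le\min(s,a)$ and $Q>C(a,\alpha)$: if $b>0$, set $b\leftarrow b-1$; otherwise set $Q\leftarrow Q+u_{k+1}-v_{a-k}$; in both cases then set $k\leftarrow k+1$. After the for-loop, return $k-1$. Computation is counted in arithmetic operations and comparisons on real numbers and evaluations of $h$ and $C$, each at unit cost. *)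

theory Defs
  imports Complex_Main "HOL-Library.Landau_Symbols" "HOL-Library.State_Monad"
begin

section \<open>Closed testing\<close>

text \<open>
  Hypotheses are indexed by \<open>{1..m}\<close>. A local test is the predicate ``the intersection hypothesis
  of \<open>J\<close> is rejected''. The empty intersection is never rejected, whatever the value of \<open>C 0 \<alpha>\<close>.
\<close>

definition local_test ::
  "(nat \<Rightarrow> real) \<Rightarrow> (real \<Rightarrow> real) \<Rightarrow> (nat \<Rightarrow> real \<Rightarrow> real) \<Rightarrow> real \<Rightarrow> nat set \<Rightarrow> bool" where
  "local_test T h C \<alpha> J \<longleftrightarrow> J \<noteq> {} \<and> (\<Sum>i\<in>J. h (T i)) \<le> C (card J) \<alpha>"

definition closed_test :: "nat \<Rightarrow> (nat set \<Rightarrow> bool) \<Rightarrow> nat set \<Rightarrow> bool" where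
  "closed_test m t I \<longleftrightarrow> (\<forall>J. I \<subseteq> J \<and> J \<subseteq> {1..m} \<longrightarrow> t J)"

definition false_discovery_bound :: "nat \<Rightarrow> (nat set \<Rightarrow> bool) \<Rightarrow> nat set \<Rightarrow> nat" where
  "false_discovery_bound m t S = Max {card I | I. I \<subseteq> S \<and> \<not> closed_test m t I}"

section \<open>The algorithm, with its operation count\<close>

text \<open>
  The state counts operations. Each arithmetic operation or comparison on reals, and each evaluation
  of \<open>h\<close> or \<open>C\<close>, is performed as its own \<open>unit_cost\<close> step; operations on indices and access to
  stored values are free.
\<close>

type_synonym 'a counted = "(nat, 'a) state"

definition unit_cost :: "'a \<Rightarrow> 'a counted" where
  "unit_cost x = State (\<lambda>n. (x, Suc n))"

definition result :: "'a counted \<Rightarrow> 'a" where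
  "result p = fst (run_state p 0)"

definition cost :: "'a counted \<Rightarrow> nat" where
  "cost p = snd (run_state p 0)"

fun foldM :: "('a \<Rightarrow> 'b \<Rightarrow> 'b counted) \<Rightarrow> 'a list \<Rightarrow> 'b \<Rightarrow> 'b counted" where
  "foldM f [] x = State_Monad.return x"
| "foldM f (a # as) x = do { y \<leftarrow> f a x; foldM f as y }"

text \<open>
  The loops work on the variables \<open>(k, b, Q)\<close>. The sequences \<open>u\<close> and \<open>v\<close> are indexed by integers,
  since \<open>b\<close> starts at \<open>-1\<close>.
\<close>

definition step1 ::
  "(int \<Rightarrow> real) \<Rightarrow> (int \<Rightarrow> real) \<Rightarrow> nat \<Rightarrow> nat \<times> int \<times> real \<Rightarrow> (nat \<times> int \<times> real) counted" where
  "step1 u v a = (\<lambda>(k, b, Q). do {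
     test \<leftarrow> unit_cost (u (int k + b + 1) \<ge> v (int a - int k - b));
     if test \<or> a = 1
     then do { Q' \<leftarrow> unit_cost (Q + u (int k + b + 1)); State_Monad.return (k, b + 1, Q') }
     else do { Q' \<leftarrow> unit_cost (Q + v (int a - int k - b)); State_Monad.return (k, b, Q') }
   })"

function step2 ::
  "(int \<Rightarrow> real) \<Rightarrow> (int \<Rightarrow> real) \<Rightarrow> (nat \<Rightarrow> real \<Rightarrow> real) \<Rightarrow> real \<Rightarrow> nat \<Rightarrow> nat
    \<Rightarrow> nat \<times> int \<times> real \<Rightarrow> (nat \<times> int \<times> real) counted" where
  "step2 u v C \<alpha> s a (k, b, Q) =
     (if k \<le> min s a then do {
        c \<leftarrow> unit_cost (C a \<alpha>);
        test \<leftarrow> unit_cost (Q > c);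
        if test then
          if b > 0 then step2 u v C \<alpha> s a (k + 1, b - 1, Q)
          else do {
            Q' \<leftarrow> unit_cost (Q + u (int k + 1));
            Q'' \<leftarrow> unit_cost (Q' - v (int a - int k));
            step2 u v C \<alpha> s a (k + 1, b, Q'')
          }
        else State_Monad.return (k, b, Q)
      }
      else State_Monad.return (k, b, Q))"
  by pat_completeness auto
termination
  by (relation "measure (\<lambda>(u, v, C, \<alpha>, s, a, k, b, Q). Suc (min s a) - k)") auto

text \<open>
  The arguments \<open>is\<close> and \<open>js\<close> are the increasing enumerations of \<open>S\<close> and of its complement.
  The value of \<open>v\<close> at negative indices is irrelevant.
\<close>

definition algorithm1 ::
  "(nat \<Rightarrow> real) \<Rightarrow> (real \<Rightarrow> real) \<Rightarrow> (nat \<Rightarrow> real \<Rightarrow> real) \<Rightarrow> real \<Rightarrow> nat list \<Rightarrow> nat list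
    \<Rightarrow> nat counted" where
  "algorithm1 T h C \<alpha> is js = do {
     let s = length is;
     let r = length js;
     us \<leftarrow> traverse_list (\<lambda>i. unit_cost (h (T i))) is;
     vs \<leftarrow> traverse_list (\<lambda>j. unit_cost (h (T j))) js;
     v0 \<leftarrow> (if s = 0 then State_Monad.return (hd vs)
           else if r = 0 then State_Monad.return (hd us)
           else unit_cost (max (hd us) (hd vs)));
     w \<leftarrow> (if s = 0 then State_Monad.return (last vs)
          else if r = 0 then State_Monad.return (last us)
          else unit_cost (min (last us) (last vs)));
     pad \<leftarrow> unit_cost (w - 1);
     let u = (\<lambda>d. if d \<le> int s then us ! nat (d - 1) else pad);
     let v = (\<lambda>d. if d = 0 then v0 else if d \<le> int r then vs ! nat (d - 1) else pad);
     (k, b, Q) \<leftarrow> foldM (\<lambda>a x. do { y \<leftarrow> step1 u v a x; step2 u v C \<alpha> s a y })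
                    [1..<s + r + 1] (1, -1, 0);
     State_Monad.return (k - 1)
   }"

end

theory Submission
  imports Defs
begin

text \<open>
  Write \<open>u\<close> and \<open>v\<close> for the decreasing sequences of the values \<open>h (T i)\<close> in \<open>S\<close> and outside
  \<open>S\<close>. For \<open>k \<ge> 1\<close> the bound is at least \<open>k\<close> iff some \<open>J\<close> with at least \<open>k\<close> elements in \<open>S\<close> is
  not rejected. Among the \<open>J\<close> of size \<open>a\<close> it suffices to look at one that maximizes the sum. Such a
  \<open>J\<close> consists of the first \<open>p\<close> terms of \<open>u\<close> and the first \<open>q\<close> terms of \<open>v\<close>, with \<open>p + q = a\<close>
  and \<open>k \<le> p\<close> (\<open>ex_subset_sum_iff\<close>), so that a question about exponentially many sets becomes one
  about pairs of prefixes.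

  As long as \<open>k\<close> is at most \<open>a\<close> and the size of \<open>S\<close>, the algorithm keeps \<open>Q\<close> equal to the largest
  such sum for the current \<open>a\<close> and \<open>k\<close>, with \<open>p = k + b\<close>. Since the sum of two concave functions of \<open>p\<close> is concave, a local condition already
  guarantees optimality: the next term of either sequence is at most the last chosen term of the
  other one, except that the \<open>k\<close> obligatory terms of \<open>u\<close> may be small. This is the invariant
  \<open>balanced\<close>. Increasing \<open>a\<close> appends the larger of the two next terms. Increasing \<open>k\<close> either
  turns a voluntary term of \<open>u\<close> into an obligatory one, or exchanges the last chosen term of \<open>v\<close>
  for the next term of \<open>u\<close>. Both preserve the invariant (\<open>step1_balanced\<close>, \<open>step2_balanced\<close>).

  As the maximal sum decreases with \<open>k\<close>, a value of \<open>k\<close> that was found to be attained need never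
  be reconsidered, and a failed test for \<open>(a, k)\<close> settles all larger \<open>k\<close> at this \<open>a\<close>. Hence the
  final \<open>k - 1\<close> is the largest attained value (\<open>main_loop\<close>). The index \<open>k\<close> never decreases and grows
  by at most the size of \<open>S\<close>, which bounds the total number of iterations of the inner loop, over all
  rounds together; that is why the cost is linear.
\<close>

section \<open>Programs with a determined result and cost\<close>

text \<open>
  A counted program may inspect or reset its counter. Requiring one cost for every initial value of
  the counter excludes this and makes costs additive under sequencing.
\<close>

definition runs :: "'a counted \<Rightarrow> 'a \<Rightarrow> nat \<Rightarrow> bool" where
  "runs p x c \<longleftrightarrow> (\<forall>n. run_state p n = (x, n + c))"

lemma runs_result_cost:
  assumes "runs p x c"
  shows "result p = x" "cost p = c"
  using assms by (auto simp: runs_def result_def cost_def)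

lemma runs_return: "runs (State_Monad.return x) x 0"
  by (simp add: runs_def)

lemma runs_unit_cost: "runs (unit_cost x) x 1"
  by (simp add: runs_def unit_cost_def)

lemma runs_bind:
  assumes "runs p x c" "runs (f x) y d"
  shows "runs (State_Monad.bind p f) y (c + d)"
  using assms by (simp add: runs_def add.assoc)

lemma runs_unit_cost_bind:
  assumes "runs (f x) y d"
  shows "runs (State_Monad.bind (unit_cost x) f) y (Suc d)"
  using assms by (simp add: runs_def unit_cost_def)

lemma runs_traverse_unit_cost:
  "runs (traverse_list (\<lambda>x. unit_cost (f x)) xs) (map f xs) (length xs)"
proof (induction xs)
  case Nil
  show ?case by (simp add: runs_return)
next
  case (Cons x xs)
  from runs_bind[OF Cons runs_return] show ?case
    by (auto intro!: runs_unit_cost_bind)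
qed

text \<open>The invariant \<open>I\<close> also speaks about the cost so far, which allows amortized bounds.\<close>

lemma runs_foldM_upt:
  fixes i j :: nat
  assumes "i \<le> j" "I i x c"
    and "\<And>a x c. i \<le> a \<Longrightarrow> a < j \<Longrightarrow> I a x c \<Longrightarrow> \<exists>y d. runs (f a x) y d \<and> I (Suc a) y (c + d)"
  shows "\<exists>y d. runs (foldM f [i..<j] x) y d \<and> I j y (c + d)"
  using assms
proof (induction "j - i" arbitrary: i x c)
  case 0
  then show ?case using runs_return[of x] by fastforce
next
  case (Suc n)
  then have "i < j" by simp
  with Suc.prems obtain y d where y: "runs (f i x) y d" "I (Suc i) y (c + d)"
    by (meson order_refl)
  have "\<exists>z e. runs (foldM f [Suc i..<j] y) z e \<and> I j z (c + d + e)"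
  proof (rule Suc.hyps(1))
    show "n = j - Suc i" "Suc i \<le> j" using Suc.hyps(2) by auto
    show "I (Suc i) y (c + d)" by fact
  qed (use Suc.prems(3) in auto)
  then obtain z e where z: "runs (foldM f [Suc i..<j] y) z e" "I j z (c + d + e)" by blast
  have "runs (foldM f [i..<j] x) z (d + e)"
    using \<open>i < j\<close> runs_bind[OF y(1), of "foldM f [Suc i..<j]"] z(1) by (simp add: upt_conv_Cons)
  with z(2) show ?case by (auto simp: add.assoc)
qed

section \<open>The greedy choice of a prefix of each sequence\<close>

lemma sum_int_interval_succ:
  fixes f :: "int \<Rightarrow> real"
  assumes "m \<le> n + 1"
  shows "sum f {m..n + 1} = sum f {m..n} + f (n + 1)"
proof -
  have "{m..n + 1} = insert (n + 1) {m..n}" using assms by auto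
  then show ?thesis by simp
qed

lemma increment_bound:
  fixes F :: "int \<Rightarrow> real"
  assumes "p \<le> p'" "\<And>i. p \<le> i \<Longrightarrow> i < p' \<Longrightarrow> F (i + 1) - F i \<le> t"
  shows "F p' - F p \<le> of_int (p' - p) * t"
  using assms
proof (induction p' rule: int_ge_induct)
  case base
  then show ?case by simp
next
  case (step i)
  have "F i - F p \<le> of_int (i - p) * t" using step by simp
  moreover have "F (i + 1) - F i \<le> t" using step by simp
  ultimately show ?case by (simp add: algebra_simps)
qed

text \<open>
  Abstract form of the padded sequences. The last two assumptions say that padding loses every
  comparison with a genuine term or with the sentinel \<open>v 0\<close>, so a comparison never selects padding
  while a genuine term remains. The sentinel is at least as large as every other term.
\<close>

locale padded_scores =
  fixes u v :: "int \<Rightarrow> real" and s r :: nat and C :: "nat \<Rightarrow> real \<Rightarrow> real" and \<alpha> :: real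
  assumes u_antimono: "1 \<le> i \<Longrightarrow> i \<le> j \<Longrightarrow> u j \<le> u i"
    and v_antimono: "0 \<le> i \<Longrightarrow> i \<le> j \<Longrightarrow> v j \<le> v i"
    and u_le_v0: "u 1 \<le> v 0"
    and u_pad: "int s < i \<Longrightarrow> 0 \<le> j \<Longrightarrow> j \<le> int r \<Longrightarrow> u i < v j"
    and v_pad: "int r < j \<Longrightarrow> 1 \<le> i \<Longrightarrow> i \<le> int s \<Longrightarrow> v j < u i"
begin

definition U :: "int \<Rightarrow> real" where "U p = sum u {1..p}"

text \<open>
  This is \<open>v 1 + \<dots> + v q\<close> for \<open>q \<ge> 0\<close> and \<open>- v 0\<close> for \<open>q = -1\<close>, so the recurrence \<open>V_succ\<close> holds
  from \<open>q = -1\<close> on. The value \<open>q = -1\<close> does occur: when the inner loop raises \<open>k\<close> from \<open>a\<close> to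
  \<open>a + 1\<close>, it has \<open>a + 1\<close> terms of \<open>u\<close> in \<open>Q\<close> and has subtracted the sentinel \<open>v 0\<close>.
\<close>

definition V :: "int \<Rightarrow> real" where "V q = sum v {0..q} - v 0"

lemma U_succ: "0 \<le> p \<Longrightarrow> U (p + 1) = U p + u (p + 1)"
  unfolding U_def by (rule sum_int_interval_succ) simp

lemma V_succ: "- 1 \<le> q \<Longrightarrow> V (q + 1) = V q + v (q + 1)"
  unfolding V_def by (simp add: sum_int_interval_succ)

lemma V_0: "V 0 = 0"
  by (simp add: V_def)

text \<open>
  With \<open>p = k + b\<close> and \<open>q = a - k - b\<close> the last two conditions are \<open>v (q + 1) \<le> u p\<close>, unless all
  \<open>p\<close> terms of \<open>u\<close> are obligatory, and \<open>u (p + 1) \<le> v q\<close>, unless \<open>q = -1\<close>. Thus no admissible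
  exchange of chosen for unchosen terms increases \<open>Q\<close>.
\<close>

definition balanced :: "nat \<Rightarrow> nat \<times> int \<times> real \<Rightarrow> bool" where
  "balanced a = (\<lambda>(k, b, Q). 1 \<le> k \<and> 0 \<le> b \<and> int k + b \<le> int a + 1 \<and>
     Q = U (int k + b) + V (int a - int k - b) \<and>
     (0 < b \<longrightarrow> v (int a - int k - b + 1) \<le> u (int k + b)) \<and>
     (0 \<le> int a - int k - b \<longrightarrow> u (int k + b + 1) \<le> v (int a - int k - b)))"

text \<open>
  Some sum of \<open>a\<close> terms, formed by a prefix of each sequence with at least \<open>k\<close> terms of \<open>u\<close>, lies
  above the critical value, that is, leads to no rejection.
\<close>

definition exceeds :: "nat \<Rightarrow> nat \<Rightarrow> bool" where
  "exceeds a k \<longleftrightarrow> (\<exists>p q. k \<le> p \<and> p \<le> s \<and> q \<le> r \<and> p + q = a \<and> C a \<alpha> < U (int p) + V (int q))"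

lemma exceeds_antimono: "exceeds a k \<Longrightarrow> k' \<le> k \<Longrightarrow> exceeds a k'"
  unfolding exceeds_def by (elim exE conjE) (intro exI conjI; (assumption | erule (1) order_trans))

text \<open>
  Local optimality implies global optimality: moving from the split \<open>(k + b, a - k - b)\<close> to another
  split replaces terms of one sequence by equally many terms of the other, and by monotonicity each
  removed term is at least the last chosen one, each added term at most the next unchosen one.
\<close>

lemma balanced_upper_bound:
  assumes "balanced a (k, b, Q)" "k \<le> p" "p + q = a"
  shows "U (int p) + V (int q) \<le> Q"
proof -
  define p0 where "p0 = int k + b"
  define q0 where "q0 = int a - int k - b"
  have inv: "1 \<le> k" "0 \<le> b" "-1 \<le> q0" "Q = U p0 + V q0"
    "0 < b \<Longrightarrow> v (q0 + 1) \<le> u p0" "0 \<le> q0 \<Longrightarrow> u (p0 + 1) \<le> v q0"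
    using assms(1) by (auto simp: balanced_def p0_def q0_def algebra_simps)
  have eq: "int q = q0 + p0 - int p" using assms(3) by (simp add: p0_def q0_def)
  consider "int p = p0" | "p0 < int p" | "int p < p0" by linarith
  then show ?thesis
  proof cases
    case 1
    then show ?thesis using inv eq by simp
  next
    case 2
    have "U (int p) - U p0 \<le> of_int (int p - p0) * u (p0 + 1)"
    proof (rule increment_bound)
      fix i assume "p0 \<le> i" "i < int p"
      then have "u (i + 1) \<le> u (p0 + 1)" "0 \<le> i" using inv by (auto intro!: u_antimono simp: p0_def)
      then show "U (i + 1) - U i \<le> u (p0 + 1)" by (simp add: U_succ)
    qed (use 2 in simp)
    moreover have "(- V q0) - (- V (int q)) \<le> of_int (q0 - int q) * (- v q0)"
    proof (rule increment_bound[where F = "\<lambda>q. - V q"])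
      fix i assume "int q \<le> i" "i < q0"
      then have "v q0 \<le> v (i + 1)" "-1 \<le> i" by (auto intro!: v_antimono)
      then show "(- V (i + 1)) - (- V i) \<le> - v q0" by (simp add: V_succ)
    qed (use 2 eq in simp)
    moreover have "of_int (int p - p0) * u (p0 + 1) \<le> of_int (int p - p0) * v q0"
      using inv 2 eq by (intro mult_left_mono) auto
    moreover have "of_int (q0 - int q) * (- v q0) = - (of_int (int p - p0) * v q0)"
      by (simp add: eq)
    ultimately show ?thesis using inv(4) by linarith
  next
    case 3
    then have "0 < b" using assms(2) by (simp add: p0_def)
    have "V (int q) - V q0 \<le> of_int (int q - q0) * v (q0 + 1)"
    proof (rule increment_bound)
      fix i assume "q0 \<le> i" "i < int q"
      then have "v (i + 1) \<le> v (q0 + 1)" "-1 \<le> i" using inv by (auto intro!: v_antimono)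
      then show "V (i + 1) - V i \<le> v (q0 + 1)" by (simp add: V_succ)
    qed (use 3 eq in simp)
    moreover have "(- U p0) - (- U (int p)) \<le> of_int (p0 - int p) * (- u p0)"
    proof (rule increment_bound[where F = "\<lambda>p. - U p"])
      fix i assume "int p \<le> i" "i < p0"
      then have "u p0 \<le> u (i + 1)" "0 \<le> i" by (auto intro!: u_antimono)
      then show "(- U (i + 1)) - (- U i) \<le> - u p0" by (simp add: U_succ)
    qed (use 3 in simp)
    moreover have "of_int (p0 - int p) * v (q0 + 1) \<le> of_int (p0 - int p) * u p0"
      using inv 3 \<open>0 < b\<close> by (intro mult_left_mono) auto
    moreover have "of_int (int q - q0) * v (q0 + 1) = of_int (p0 - int p) * v (q0 + 1)"
      "of_int (p0 - int p) * (- u p0) = - (of_int (p0 - int p) * u p0)"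
      by (simp_all add: eq)
    ultimately show ?thesis using inv(4) by linarith
  qed
qed

text \<open>
  Padding is never among the chosen terms: if one sequence were overrun, then by \<open>a \<le> s + r\<close> the
  other would have a genuine term or the sentinel left, which beats the padding. If \<open>q = -1\<close>, then
  \<open>v 0 \<le> u p \<le> u 1 \<le> v 0\<close>, so the subtracted sentinel cancels the surplus term \<open>u p\<close> and \<open>Q\<close> is
  the genuine sum \<open>U (p - 1)\<close>.
\<close>

lemma balanced_attained:
  assumes "balanced a (k, b, Q)" "k \<le> s" "k \<le> a" "a \<le> s + r"
  obtains p q where "k \<le> p" "p \<le> s" "q \<le> r" "p + q = a" "Q = U (int p) + V (int q)"
proof -
  define p where "p = int k + b"
  define q where "q = int a - int k - b"
  have inv: "1 \<le> k" "0 \<le> b" "-1 \<le> q" "Q = U p + V q"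
    "0 < b \<Longrightarrow> v (q + 1) \<le> u p" "0 \<le> q \<Longrightarrow> u (p + 1) \<le> v q"
    using assms(1) by (auto simp: balanced_def p_def q_def algebra_simps)
  have sum: "p + q = int a" by (simp add: p_def q_def)
  have p: "p \<le> int s"
  proof (rule ccontr)
    assume *: "\<not> p \<le> int s"
    then have "0 < b" using assms(2) by (simp add: p_def)
    then have "v (q + 1) \<le> u p" by (rule inv)
    moreover have "q + 1 \<le> int r" using * sum assms(4) by linarith
    ultimately show False using u_pad[of p "q + 1"] * inv(3) by simp
  qed
  have q: "q \<le> int r"
  proof (rule ccontr)
    assume *: "\<not> q \<le> int r"
    then have "u (p + 1) \<le> v q" by (intro inv) simp
    moreover have "p + 1 \<le> int s" using * sum assms(4) by linarith
    ultimately show False using v_pad[of q "p + 1"] * inv by (simp add: p_def)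
  qed
  show thesis
  proof (cases "0 \<le> q")
    case True
    show thesis
      by (rule that[of "nat p" "nat q"]) (use True p q inv sum in \<open>auto simp: p_def\<close>)
  next
    case False
    then have q: "q = -1" using inv by simp
    then have b: "0 < b" using assms(3) inv by (simp add: q_def)
    then have "v 0 \<le> u p" using inv q by simp
    moreover have "u p \<le> u 1" using inv by (intro u_antimono) (auto simp: p_def)
    ultimately have "u p = v 0" using u_le_v0 by simp
    moreover have "U p = U (p - 1) + u p" using U_succ[of "p - 1"] inv by (simp add: p_def)
    moreover have "V q = - v 0" by (simp add: V_def q)
    ultimately have "Q = U (p - 1) + V 0" using inv V_0 by simp
    then show thesis
      by (intro that[of "nat (p - 1)" 0]) (use p b q inv sum in \<open>auto simp: p_def\<close>)
  qed
qed

lemma exceeds_iff: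
  assumes "balanced a (k, b, Q)" "a \<le> s + r"
  shows "exceeds a k \<longleftrightarrow> k \<le> min s a \<and> C a \<alpha> < Q"
proof
  assume "exceeds a k"
  then obtain p q where "k \<le> p" "p \<le> s" "p + q = a" "C a \<alpha> < U (int p) + V (int q)"
    unfolding exceeds_def by blast
  with balanced_upper_bound[OF assms(1), of p q] show "k \<le> min s a \<and> C a \<alpha> < Q" by auto
next
  assume *: "k \<le> min s a \<and> C a \<alpha> < Q"
  then obtain p q where "k \<le> p" "p \<le> s" "q \<le> r" "p + q = a" "Q = U (int p) + V (int q)"
    using balanced_attained[OF assms(1)] assms(2) by auto
  with * show "exceeds a k" unfolding exceeds_def by auto
qed

section \<open>The loops preserve the greedy choice\<close>

text \<open>
  At \<open>b = -1\<close> the first round has to take \<open>u 1\<close> even if it is smaller than \<open>v 1\<close>, because the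
  first of the \<open>k = 1\<close> obligatory terms is still missing.
\<close>

lemma step1_first: "\<exists>x. runs (step1 u v 1 (1, -1, 0)) x 2 \<and> fst x = 1 \<and> balanced 1 x"
proof -
  have "runs (step1 u v 1 (1, -1, 0)) (1, 0, u 1) 2"
    by (simp add: step1_def numeral_2_eq_2 runs_unit_cost_bind runs_return)
  moreover have "u 2 \<le> v 0" using u_antimono[of 1 2] u_le_v0 by simp
  then have "balanced 1 (1, 0, u 1)"
    by (simp add: balanced_def U_def V_0)
  ultimately show ?thesis by (intro exI[of _ "(1, 0, u 1)"]) simp
qed

lemma step1_balanced:
  assumes "balanced a (k, b, Q)" "1 \<le> a"
  shows "\<exists>x. runs (step1 u v (Suc a) (k, b, Q)) x 2 \<and> fst x = k \<and> balanced (Suc a) x"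
proof -
  define p where "p = int k + b"
  define q where "q = int a - int k - b"
  have inv: "1 \<le> k" "0 \<le> b" "-1 \<le> q" "Q = U p + V q"
    "0 < b \<Longrightarrow> v (q + 1) \<le> u p" "0 \<le> q \<Longrightarrow> u (p + 1) \<le> v q"
    using assms(1) by (auto simp: balanced_def p_def q_def algebra_simps)
  have eqs: "int k + b = p" "int (Suc a) - int k - b = q + 1"
    "int k + (b + 1) = p + 1" "int (Suc a) - int k - (b + 1) = q"
    by (simp_all add: p_def q_def)
  have pos: "1 \<le> p" "p \<le> int a + 1" using inv by (simp_all add: p_def q_def)
  show ?thesis
  proof (cases "v (q + 1) \<le> u (p + 1)")
    case True
    have "runs (step1 u v (Suc a) (k, b, Q)) (k, b + 1, Q + u (p + 1)) 2"
      unfolding step1_def prod.case numeral_2_eq_2 eqs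
      by (rule runs_unit_cost_bind) (use True in \<open>simp add: runs_unit_cost_bind runs_return\<close>)
    moreover have "u (p + 1 + 1) \<le> u (p + 1)" using pos by (intro u_antimono) auto
    then have "balanced (Suc a) (k, b + 1, Q + u (p + 1))"
      unfolding balanced_def prod.case eqs using inv True pos by (auto simp: U_succ)
    ultimately show ?thesis by (intro exI[of _ "(k, b + 1, Q + u (p + 1))"]) simp
  next
    case False
    have "runs (step1 u v (Suc a) (k, b, Q)) (k, b, Q + v (q + 1)) 2"
      unfolding step1_def prod.case numeral_2_eq_2 eqs
      by (rule runs_unit_cost_bind)
        (use False assms(2) in \<open>simp add: runs_unit_cost_bind runs_return\<close>)
    moreover have "v (q + 1 + 1) \<le> v (q + 1)" using inv by (intro v_antimono) auto
    then have "balanced (Suc a) (k, b, Q + v (q + 1))"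
      unfolding balanced_def prod.case eqs using inv False pos by (auto simp: V_succ)
    ultimately show ?thesis by (intro exI[of _ "(k, b, Q + v (q + 1))"]) simp
  qed
qed

lemma balanced_drop_surplus:
  assumes "balanced a (k, b, Q)" "0 < b"
  shows "balanced a (k + 1, b - 1, Q)"
  using assms by (simp add: balanced_def algebra_simps)

lemma balanced_exchange:
  assumes "balanced a (k, 0, Q)" "k \<le> a"
  shows "balanced a (k + 1, 0, Q + u (int k + 1) - v (int a - int k))"
proof -
  define q where "q = int a - int k"
  have q: "0 \<le> q" using assms by (simp add: q_def)
  have "u (int k + 2) \<le> u (int k + 1)" using assms by (intro u_antimono) auto
  also have "\<dots> \<le> v q" using assms q by (simp add: balanced_def q_def)
  finally have "0 \<le> q - 1 \<longrightarrow> u (int k + 2) \<le> v (q - 1)"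
    using v_antimono[of "q - 1" q] by auto
  moreover have "V q = V (q - 1) + v q" using V_succ[of "q - 1"] q by simp
  moreover have "U (int k + 1) = U (int k) + u (int k + 1)" by (simp add: U_succ)
  ultimately show ?thesis using assms by (simp add: balanced_def q_def algebra_simps)
qed

declare step2.simps [simp del]

text \<open>
  The cost is bounded by the increase of the potential \<open>4 * k\<close>, up to the 2 units of the test that
  ends the loop. Every increment of \<open>k\<close> is justified by a sum above the critical value, and the
  loop stops at a \<open>k\<close> for which there is none of size \<open>a\<close>; for \<open>k > min s a\<close> this holds because
  \<open>k\<close> terms of \<open>u\<close> cannot be chosen at all.
\<close>

lemma step2_balanced:
  assumes "balanced a (k, b, Q)" "a \<le> s + r"
  shows "\<exists>k' b' Q' c. runs (step2 u v C \<alpha> s a (k, b, Q)) (k', b', Q') c \<and>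
    balanced a (k', b', Q') \<and> k \<le> k' \<and> c + 4 * k \<le> 4 * k' + 2 \<and>
    \<not> exceeds a k' \<and> (k' = k \<or> exceeds a (k' - 1))"
  using assms
proof (induction "Suc (min s a) - k" arbitrary: k b Q rule: less_induct)
  case less
  note bal = less.prems(1)
  let ?p = "step2 u v C \<alpha> s a (k, b, Q)"
  consider "\<not> k \<le> min s a" | "k \<le> min s a" "\<not> C a \<alpha> < Q" | "exceeds a k" "k \<le> min s a" "C a \<alpha> < Q"
    using exceeds_iff[OF bal less.prems(2)] by argo
  then show ?case
  proof cases
    case 1
    have "runs ?p (k, b, Q) 0" using 1 by (subst step2.simps) (auto simp: runs_return)
    moreover have "\<not> exceeds a k" using 1 exceeds_iff[OF bal less.prems(2)] by blast
    ultimately show ?thesis using bal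
      by (intro exI[of _ k] exI[of _ b] exI[of _ Q] exI[of _ 0]) simp
  next
    case 2
    have "runs ?p (k, b, Q) 2"
      using 2 by (subst step2.simps) (simp add: numeral_2_eq_2 runs_unit_cost_bind runs_return)
    moreover have "\<not> exceeds a k" using 2 exceeds_iff[OF bal less.prems(2)] by blast
    ultimately show ?thesis using bal
      by (intro exI[of _ k] exI[of _ b] exI[of _ Q] exI[of _ 2]) simp
  next
    case 3
    \<comment> \<open>Both branches raise \<open>k\<close> by one, so the potential pays for up to 4 units of their cost.\<close>
    have iterate: ?thesis
      if next_bal: "balanced a (k + 1, b', Q')" and "d \<le> 4"
        and run: "\<And>x c. runs (step2 u v C \<alpha> s a (k + 1, b', Q')) x c \<Longrightarrow> runs ?p x (c + d)"
      for b' Q' d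
    proof -
      have "Suc (min s a) - (k + 1) < Suc (min s a) - k" using 3(2) by linarith
      from less.hyps[OF this next_bal less.prems(2)]
      obtain k' b'' Q'' c where *: "runs (step2 u v C \<alpha> s a (k + 1, b', Q')) (k', b'', Q'') c"
        "balanced a (k', b'', Q'')" "k + 1 \<le> k'" "c + 4 * (k + 1) \<le> 4 * k' + 2"
        "\<not> exceeds a k'" "k' = k + 1 \<or> exceeds a (k' - 1)"
        by blast
      have "exceeds a (k' - 1)" using * 3(1) by auto
      with run[OF *(1)] *(2-5) \<open>d \<le> 4\<close> show ?thesis
        by (intro exI[of _ k'] exI[of _ b''] exI[of _ Q''] exI[of _ "c + d"]) simp
    qed
    show ?thesis
    proof (cases "0 < b")
      case True
      show ?thesis
      proof (rule iterate[where d = 2])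
        show "balanced a (k + 1, b - 1, Q)" by (rule balanced_drop_surplus[OF bal True])
        fix x c assume "runs (step2 u v C \<alpha> s a (k + 1, b - 1, Q)) x c"
        then have "runs ?p x (Suc (Suc c))"
          by (subst step2.simps) (use 3 True in \<open>simp add: runs_unit_cost_bind\<close>)
        then show "runs ?p x (c + 2)" by simp
      qed simp
    next
      case False
      then have b: "b = 0" using bal by (simp add: balanced_def)
      show ?thesis
      proof (rule iterate[where d = 4])
        show "balanced a (k + 1, 0, Q + u (int k + 1) - v (int a - int k))"
          using balanced_exchange[of a k Q] bal b 3(2) by simp
        fix x c assume "runs (step2 u v C \<alpha> s a (k + 1, 0, Q + u (int k + 1) - v (int a - int k))) x c"
        then have "runs ?p x (Suc (Suc (Suc (Suc c))))"
          by (subst step2.simps) (use 3 b in \<open>simp add: runs_unit_cost_bind\<close>)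
        then show "runs ?p x (c + 4)" by (simp add: eval_nat_numeral)
      qed simp
    qed
  qed
qed

text \<open>
  Each round costs 2 in the first step and at most 2 for the last test of the second, and the increments of
  \<open>k\<close> cost \<open>4 * s\<close> in total. That a size \<open>a\<close> of an earlier round does not exceed at the final \<open>k\<close>
  follows from antitonicity in \<open>k\<close>.
\<close>

lemma main_loop:
  assumes "1 \<le> s + r"
  obtains k b Q c where
    "runs (foldM (\<lambda>a x. do { y \<leftarrow> step1 u v a x; step2 u v C \<alpha> s a y }) [1..<s + r + 1] (1, -1, 0))
       (k, b, Q) c"
    "1 \<le> k" "c \<le> 8 * (s + r)"
    "\<And>a. a \<le> s + r \<Longrightarrow> \<not> exceeds a k"
    "k = 1 \<or> (\<exists>a. exceeds a (k - 1))"
proof -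
  \<comment> \<open>The loop starts at \<open>b = -1\<close>, where \<open>balanced\<close> fails, so the first round is treated apart.\<close>
  \<comment> \<open>Before round \<open>a\<close> the cost is at most \<open>4 * (a - 1) + 4 * (k - 1)\<close>.\<close>
  define I where "I = (\<lambda>a (k, b, Q) c. if a = 1 then (k, b, Q) = (1, -1, 0) \<and> c = 0
    else balanced (a - 1) (k, b, Q) \<and> (\<forall>a'<a. \<not> exceeds a' k) \<and>
      (k = 1 \<or> (\<exists>a'. exceeds a' (k - 1))) \<and> c + 8 \<le> 4 * a + 4 * k)"
  have "\<exists>y d. runs (foldM (\<lambda>a x. do { y \<leftarrow> step1 u v a x; step2 u v C \<alpha> s a y })
      [1..<s + r + 1] (1, -1, 0)) y d \<and> I (s + r + 1) y (0 + d)"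
  proof (rule runs_foldM_upt[where I = I])
    show "I 1 (1, -1, 0) 0" by (simp add: I_def)
    fix a x c
    assume a: "1 \<le> a" "a < s + r + 1" and "I a x c"
    obtain k b Q where x: "x = (k, b, Q)" by (cases x)
    have k: "1 \<le> k" "\<And>a'. a' < a \<Longrightarrow> \<not> exceeds a' k" "k = 1 \<or> (\<exists>a'. exceeds a' (k - 1))"
      "c + 8 \<le> 4 * a + 4 * k"
      using \<open>I a x c\<close> a by (auto simp: I_def x balanced_def exceeds_def split: if_splits)
    have "\<exists>y. runs (step1 u v a x) y 2 \<and> fst y = k \<and> balanced a y"
    proof (cases "a = 1")
      case True
      then show ?thesis using step1_first \<open>I a x c\<close> by (simp add: I_def x)
    next
      case False
      then have "balanced (a - 1) (k, b, Q)" "1 \<le> a - 1" "a = Suc (a - 1)"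
        using \<open>I a x c\<close> a by (auto simp: I_def x)
      then show ?thesis using step1_balanced x by metis
    qed
    then obtain b1 Q1 where y: "runs (step1 u v a x) (k, b1, Q1) 2" "balanced a (k, b1, Q1)"
      by (metis prod.collapse)
    from step2_balanced[OF y(2)] a obtain k' b' Q' d where z:
      "runs (step2 u v C \<alpha> s a (k, b1, Q1)) (k', b', Q') d"
      "balanced a (k', b', Q')" "k \<le> k'" "d + 4 * k \<le> 4 * k' + 2"
      "\<not> exceeds a k'" "k' = k \<or> exceeds a (k' - 1)"
      by auto
    have "\<forall>a'<Suc a. \<not> exceeds a' k'"
      using z(3,5) k(2) exceeds_antimono less_antisym by blast
    moreover have "k' = 1 \<or> (\<exists>a'. exceeds a' (k' - 1))" using z(6) k(3) by blast
    ultimately have "I (Suc a) (k', b', Q') (c + (2 + d))"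
      using z k(4) a by (simp add: I_def)
    moreover have "runs (do { y \<leftarrow> step1 u v a x; step2 u v C \<alpha> s a y }) (k', b', Q') (2 + d)"
      by (rule runs_bind) (rule y z)+
    ultimately show "\<exists>y d. runs (do { y \<leftarrow> step1 u v a x; step2 u v C \<alpha> s a y }) y d \<and>
        I (Suc a) y (c + d)" by blast
  qed simp
  then obtain k b Q c where run: "runs (foldM (\<lambda>a x. do { y \<leftarrow> step1 u v a x; step2 u v C \<alpha> s a y })
      [1..<s + r + 1] (1, -1, 0)) (k, b, Q) c" and inv: "I (s + r + 1) (k, b, Q) c"
    by auto
  have post: "balanced (s + r) (k, b, Q)" "\<forall>a<s + r + 1. \<not> exceeds a k"
    "k = 1 \<or> (\<exists>a. exceeds a (k - 1))" "c + 8 \<le> 4 * (s + r + 1) + 4 * k"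
    using inv assms by (auto simp: I_def split: if_splits)
  \<comment> \<open>\<open>k - 1\<close> counts elements of the first sequence, so at most \<open>s\<close> iterations raised \<open>k\<close>.\<close>
  have "k - 1 \<le> s" using post(3) by (auto simp: exceeds_def)
  with post(4) have "c \<le> 8 * (s + r)" by simp
  show thesis
  proof (rule that[OF run _ \<open>c \<le> 8 * (s + r)\<close> _ post(3)])
    show "1 \<le> k" using post(1) by (simp add: balanced_def)
    show "\<not> exceeds a k" if "a \<le> s + r" for a using post(2) that by simp
  qed
qed

end

section \<open>Subsets with a large sum\<close>

text \<open>The largest element of \<open>A\<close> is at least \<open>card A - 1\<close>, so it may be moved down to that index.\<close>

lemma sum_le_sum_prefix:
  fixes f :: "nat \<Rightarrow> real"
  assumes "antimono_on {..<n} f" "A \<subseteq> {..<n}"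
  shows "sum f A \<le> sum f {..<card A}"
proof -
  have "finite A" using assms(2) finite_subset by blast
  then show ?thesis using assms(2)
  proof (induction A rule: finite_linorder_max_induct)
    case empty
    show ?case by simp
  next
    case (insert b A)
    have "A \<subseteq> {..<b}" using insert by auto
    then have "card A \<le> b" using card_mono[of "{..<b}" A] by simp
    then have "f b \<le> f (card A)"
      using insert by (intro monotone_onD[OF assms(1)]) auto
    moreover have "b \<notin> A" using insert by auto
    ultimately show ?case using insert by auto
  qed
qed

lemma sum_nth_lessThan:
  fixes f :: "'a \<Rightarrow> real"
  assumes "distinct xs" "N \<subseteq> {..<length xs}"
  shows "sum f ((!) xs ` N) = (\<Sum>i\<in>N. f (xs ! i))"
proof -
  have "inj_on ((!) xs) N" using assms by (intro inj_on_nth) auto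
  then show ?thesis by (simp add: sum.reindex)
qed

lemma sum_le_sum_nth_prefix:
  fixes f :: "'a \<Rightarrow> real"
  assumes "distinct xs" "antimono_on {..<length xs} (\<lambda>i. f (xs ! i))" "A \<subseteq> set xs"
  shows "sum f A \<le> (\<Sum>i<card A. f (xs ! i))"
proof -
  define N where "N = {i. i < length xs \<and> xs ! i \<in> A}"
  have N: "N \<subseteq> {..<length xs}" by (auto simp: N_def)
  have A: "A = (!) xs ` N" using assms(3) by (force simp: N_def in_set_conv_nth)
  moreover have "inj_on ((!) xs) N" using assms(1) N by (intro inj_on_nth) auto
  ultimately have "card A = card N" by (simp add: card_image)
  with sum_le_sum_prefix[OF assms(2) N] sum_nth_lessThan[OF assms(1) N, of f] A
  show ?thesis by simp
qed

text \<open>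
  Among the sets with prescribed numbers of elements in each of two classes, the union of the two
  prefixes has the largest sum.
\<close>

lemma ex_subset_sum_iff:
  fixes f :: "'a \<Rightarrow> real"
  assumes "distinct xs" "antimono_on {..<length xs} (\<lambda>i. f (xs ! i))"
    and "distinct ys" "antimono_on {..<length ys} (\<lambda>i. f (ys ! i))"
    and disj: "set xs \<inter> set ys = {}"
  shows "(\<exists>J \<subseteq> set xs \<union> set ys. card J = a \<and> k \<le> card (J \<inter> set xs) \<and> c < sum f J) \<longleftrightarrow>
    (\<exists>p q. k \<le> p \<and> p \<le> length xs \<and> q \<le> length ys \<and> p + q = a \<and>
      c < (\<Sum>i<p. f (xs ! i)) + (\<Sum>i<q. f (ys ! i)))"
proof
  assume "\<exists>J \<subseteq> set xs \<union> set ys. card J = a \<and> k \<le> card (J \<inter> set xs) \<and> c < sum f J"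
  then obtain J where J: "J \<subseteq> set xs \<union> set ys" "card J = a" "k \<le> card (J \<inter> set xs)" "c < sum f J"
    by blast
  have split: "J = (J \<inter> set xs) \<union> (J \<inter> set ys)" "(J \<inter> set xs) \<inter> (J \<inter> set ys) = {}"
    using J(1) disj by auto
  have "card J = card (J \<inter> set xs) + card (J \<inter> set ys)"
    by (subst split(1), rule card_Un_disjoint) (use split(2) in auto)
  moreover have "sum f J = sum f (J \<inter> set xs) + sum f (J \<inter> set ys)"
    by (subst split(1), rule sum.union_disjoint) (use split(2) in auto)
  moreover have "card (J \<inter> set xs) \<le> length xs" "card (J \<inter> set ys) \<le> length ys"
    using card_mono[of "set xs" "J \<inter> set xs"] card_mono[of "set ys" "J \<inter> set ys"] assms(1,3)
    by (auto simp: distinct_card)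
  moreover have "sum f (J \<inter> set xs) \<le> (\<Sum>i<card (J \<inter> set xs). f (xs ! i))"
    "sum f (J \<inter> set ys) \<le> (\<Sum>i<card (J \<inter> set ys). f (ys ! i))"
    using assms by (auto intro!: sum_le_sum_nth_prefix)
  ultimately show "\<exists>p q. k \<le> p \<and> p \<le> length xs \<and> q \<le> length ys \<and> p + q = a \<and>
      c < (\<Sum>i<p. f (xs ! i)) + (\<Sum>i<q. f (ys ! i))"
    using J by (intro exI[of _ "card (J \<inter> set xs)"] exI[of _ "card (J \<inter> set ys)"]) auto
next
  assume "\<exists>p q. k \<le> p \<and> p \<le> length xs \<and> q \<le> length ys \<and> p + q = a \<and>
      c < (\<Sum>i<p. f (xs ! i)) + (\<Sum>i<q. f (ys ! i))"
  then obtain p q where pq: "k \<le> p" "p \<le> length xs" "q \<le> length ys" "p + q = a"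
      "c < (\<Sum>i<p. f (xs ! i)) + (\<Sum>i<q. f (ys ! i))"
    by blast
  define X Y where "X = (!) xs ` {..<p}" and "Y = (!) ys ` {..<q}"
  have sub: "X \<subseteq> set xs" "Y \<subseteq> set ys" using pq by (auto simp: X_def Y_def)
  then have disjXY: "X \<inter> Y = {}" "(X \<union> Y) \<inter> set xs = X" using disj by auto
  have "card X = p" "card Y = q"
    unfolding X_def Y_def using assms(1,3) pq by (auto simp: card_image inj_on_nth)
  moreover have "finite X" "finite Y" by (simp_all add: X_def Y_def)
  moreover have "sum f X = (\<Sum>i<p. f (xs ! i))" "sum f Y = (\<Sum>i<q. f (ys ! i))"
    unfolding X_def Y_def using assms(1,3) pq by (auto intro!: sum_nth_lessThan)
  ultimately show "\<exists>J \<subseteq> set xs \<union> set ys. card J = a \<and> k \<le> card (J \<inter> set xs) \<and> c < sum f J"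
    using pq sub disjXY
    by (intro exI[of _ "X \<union> Y"]) (auto simp: card_Un_disjoint sum.union_disjoint)
qed

text \<open>
  A set \<open>I \<subseteq> S\<close> escapes rejection iff it lies in \<open>J \<inter> S\<close> for some \<open>J\<close> that the local test does
  not reject, so the two maximal cardinalities agree.
\<close>

lemma false_discovery_bound_eqI:
  assumes "finite S" "\<not> t {}"
    and attained: "k = 0 \<or> (\<exists>J \<subseteq> {1..m}. \<not> t J \<and> k \<le> card (J \<inter> S))"
    and bound: "\<And>J. J \<subseteq> {1..m} \<Longrightarrow> \<not> t J \<Longrightarrow> card (J \<inter> S) \<le> k"
  shows "false_discovery_bound m t S = k"
  unfolding false_discovery_bound_def
proof (rule Max_eqI)
  have "{card I | I. I \<subseteq> S \<and> \<not> closed_test m t I} \<subseteq> card ` Pow S" by auto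
  then show "finite {card I | I. I \<subseteq> S \<and> \<not> closed_test m t I}"
    using assms(1) finite_subset by blast
next
  fix y assume "y \<in> {card I | I. I \<subseteq> S \<and> \<not> closed_test m t I}"
  then obtain I J where "y = card I" "I \<subseteq> J \<inter> S" "J \<subseteq> {1..m}" "\<not> t J"
    by (auto simp: closed_test_def)
  then show "y \<le> k" using bound[of J] card_mono[of "J \<inter> S" I] assms(1) by fastforce
next
  have "\<exists>I J. I \<subseteq> J \<inter> S \<and> card I = k \<and> J \<subseteq> {1..m} \<and> \<not> t J"
  proof (cases "k = 0")
    case True
    then show ?thesis using assms(2) by (intro exI[of _ "{}"]) auto
  next
    case False
    with attained show ?thesis by (meson obtain_subset_with_card_n)
  qed
  then show "k \<in> {card I | I. I \<subseteq> S \<and> \<not> closed_test m t I}"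
    by (auto simp: closed_test_def)
qed

section \<open>Padding the sorted score lists\<close>

lemma sum_int_interval_eq_sum_nth:
  fixes f :: "int \<Rightarrow> real"
  assumes "\<And>i. i < p \<Longrightarrow> f (int i + 1) = g i"
  shows "sum f {1..int p} = (\<Sum>i<p. g i)"
  using assms
proof (induction p)
  case 0
  show ?case by simp
next
  case (Suc p)
  have "sum f {1..int p + 1} = sum f {1..int p} + f (int p + 1)"
    by (rule sum_int_interval_succ) simp
  with Suc show ?case by (simp add: add.commute)
qed

text \<open>
  Since the lists are decreasing, \<open>v0\<close> is the greatest and \<open>w\<close> the least of all scores, so \<open>w - 1\<close>
  lies strictly below every score.
\<close>

lemma padded_scores_of_lists:
  fixes us vs :: "real list"
  assumes s: "s = length us" and r: "r = length vs" and "1 \<le> s + r"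
    and us: "antimono_on {..<s} ((!) us)" and vs: "antimono_on {..<r} ((!) vs)"
    and v0: "v0 = (if s = 0 then hd vs else if r = 0 then hd us else max (hd us) (hd vs))"
    and w: "w = (if s = 0 then last vs else if r = 0 then last us else min (last us) (last vs))"
  shows "padded_scores (\<lambda>d. if d \<le> int s then us ! nat (d - 1) else w - 1)
    (\<lambda>d. if d = 0 then v0 else if d \<le> int r then vs ! nat (d - 1) else w - 1) s r"
proof -
  have us_anti: "us ! j \<le> us ! i" if "i \<le> j" "j < s" for i j
    using monotone_onD[OF us, of i j] that by simp
  have vs_anti: "vs ! j \<le> vs ! i" if "i \<le> j" "j < r" for i j
    using monotone_onD[OF vs, of i j] that by simp
  have us_bounds: "w \<le> us ! i \<and> us ! i \<le> v0" if "i < s" for i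
  proof -
    have "us \<noteq> []" using that s by auto
    then have "hd us = us ! 0" "last us = us ! (s - 1)"
      by (simp_all add: hd_conv_nth last_conv_nth s)
    then show ?thesis using us_anti[of 0 i] us_anti[of i "s - 1"] that by (auto simp: v0 w le_max_iff_disj min_le_iff_disj)
  qed
  have vs_bounds: "w \<le> vs ! i \<and> vs ! i \<le> v0" if "i < r" for i
  proof -
    have "vs \<noteq> []" using that r by auto
    then have "hd vs = vs ! 0" "last vs = vs ! (r - 1)"
      by (simp_all add: hd_conv_nth last_conv_nth r)
    then show ?thesis using vs_anti[of 0 i] vs_anti[of i "r - 1"] that by (auto simp: v0 w le_max_iff_disj min_le_iff_disj)
  qed
  have "w \<le> v0"
  proof (cases "s = 0")
    case True
    then show ?thesis using vs_bounds[of 0] assms(3) by auto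
  next
    case False
    then show ?thesis using us_bounds[of 0] by auto
  qed
  have u_index: "nat (d - 1) < s" if "1 \<le> d" "d \<le> int s" for d
    using that by linarith
  have v_index: "nat (d - 1) < r" if "1 \<le> d" "d \<le> int r" for d
    using that by linarith
  note u_bounds = us_bounds[OF u_index] and v_bounds = vs_bounds[OF v_index]
  show ?thesis
  proof
    fix i j :: int
    assume ij: "1 \<le> i" "i \<le> j"
    then show "(if j \<le> int s then us ! nat (j - 1) else w - 1)
        \<le> (if i \<le> int s then us ! nat (i - 1) else w - 1)"
      using us_anti[of "nat (i - 1)" "nat (j - 1)"] u_bounds[of i] u_index[of j] by auto
  next
    fix i j :: int
    assume ij: "0 \<le> i" "i \<le> j"
    then show "(if j = 0 then v0 else if j \<le> int r then vs ! nat (j - 1) else w - 1)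
        \<le> (if i = 0 then v0 else if i \<le> int r then vs ! nat (i - 1) else w - 1)"
      using vs_anti[of "nat (i - 1)" "nat (j - 1)"] v_bounds[of i] v_bounds[of j] v_index[of j]
        \<open>w \<le> v0\<close> by auto
  next
    show "(if 1 \<le> int s then us ! nat (1 - 1) else w - 1)
      \<le> (if (0::int) = 0 then v0 else if 0 \<le> int r then vs ! nat (0 - 1) else w - 1)"
      using us_bounds[of 0] \<open>w \<le> v0\<close> by auto
  next
    fix i j :: int
    assume "int s < i" "0 \<le> j" "j \<le> int r"
    then show "(if i \<le> int s then us ! nat (i - 1) else w - 1)
        < (if j = 0 then v0 else if j \<le> int r then vs ! nat (j - 1) else w - 1)"
      using v_bounds[of j] \<open>w \<le> v0\<close> by auto
  next
    fix i j :: int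
    assume "int r < j" "1 \<le> i" "i \<le> int s"
    then show "(if j = 0 then v0 else if j \<le> int r then vs ! nat (j - 1) else w - 1)
        < (if i \<le> int s then us ! nat (i - 1) else w - 1)"
      using u_bounds[of i] by auto
  qed
qed

section \<open>Correctness and cost of the algorithm\<close>

text \<open>
  The constant 3 pays for \<open>v0\<close>, \<open>w\<close> and the padding, and the evaluations of \<open>h\<close> cost one unit for
  each score.
\<close>

lemma runs_algorithm1:
  fixes T :: "nat \<Rightarrow> real" and h :: "real \<Rightarrow> real" and C :: "nat \<Rightarrow> real \<Rightarrow> real" and \<alpha> :: real
    and xs ys :: "nat list"
  defines "s \<equiv> length xs" and "r \<equiv> length ys"
  defines "large \<equiv> \<lambda>a k. \<exists>p q. k \<le> p \<and> p \<le> s \<and> q \<le> r \<and> p + q = a \<and>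
    C a \<alpha> < (\<Sum>i<p. h (T (xs ! i))) + (\<Sum>i<q. h (T (ys ! i)))"
  assumes nonempty: "1 \<le> s + r"
    and xs: "antimono_on {..<s} (\<lambda>i. h (T (xs ! i)))"
    and ys: "antimono_on {..<r} (\<lambda>i. h (T (ys ! i)))"
  obtains e c where "runs (algorithm1 T h C \<alpha> xs ys) e c" "c \<le> 9 * (s + r) + 3"
    "e = 0 \<or> (\<exists>a. large a e)" "\<And>a. \<not> large a (Suc e)"
proof -
  define us vs where "us = map (\<lambda>i. h (T i)) xs" and "vs = map (\<lambda>j. h (T j)) ys"
  define v0 where "v0 = (if s = 0 then hd vs else if r = 0 then hd us else max (hd us) (hd vs))"
  define w where
    "w = (if s = 0 then last vs else if r = 0 then last us else min (last us) (last vs))"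
  define u where "u = (\<lambda>d. if d \<le> int s then us ! nat (d - 1) else w - 1)"
  define v where "v = (\<lambda>d. if d = 0 then v0 else if d \<le> int r then vs ! nat (d - 1) else w - 1)"
  have "antimono_on {..<s} ((!) us)" "antimono_on {..<r} ((!) vs)"
    using xs ys by (auto simp: monotone_on_def us_def vs_def s_def r_def)
  then interpret padded_scores u v s r C \<alpha>
    unfolding u_def v_def using nonempty v0_def w_def
    by (intro padded_scores_of_lists) (auto simp: s_def r_def us_def vs_def)
  have U_eq: "U (int p) = (\<Sum>i<p. h (T (xs ! i)))" if "p \<le> s" for p
    unfolding U_def using that
    by (intro sum_int_interval_eq_sum_nth) (auto simp: u_def us_def s_def)
  have V_eq: "V (int q) = (\<Sum>i<q. h (T (ys ! i)))" if "q \<le> r" for q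
  proof -
    have "{0..int q} = insert 0 {1..int q}" by auto
    then have "V (int q) = sum v {1..int q}" by (simp add: V_def)
    also have "\<dots> = (\<Sum>i<q. h (T (ys ! i)))"
      using that by (intro sum_int_interval_eq_sum_nth) (auto simp: v_def vs_def r_def)
    finally show ?thesis .
  qed
  have exceeds_eq: "exceeds a k \<longleftrightarrow> large a k" for a k
    unfolding exceeds_def large_def using U_eq V_eq by metis
  obtain k b Q c where loop:
    "runs (foldM (\<lambda>a x. do { y \<leftarrow> step1 u v a x; step2 u v C \<alpha> s a y }) [1..<s + r + 1] (1, -1, 0))
       (k, b, Q) c"
    "1 \<le> k" "c \<le> 8 * (s + r)"
    "\<And>a. a \<le> s + r \<Longrightarrow> \<not> exceeds a k" "k = 1 \<or> (\<exists>a. exceeds a (k - 1))"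
    using main_loop[OF nonempty] by blast
  define c0 where "c0 = (if s = 0 \<or> r = 0 then 0 else 1 :: nat)"
  have us: "runs (traverse_list (\<lambda>i. unit_cost (h (T i))) xs) us s"
    and vs: "runs (traverse_list (\<lambda>j. unit_cost (h (T j))) ys) vs r"
    unfolding us_def vs_def s_def r_def by (rule runs_traverse_unit_cost)+
  have v0: "runs (if s = 0 then State_Monad.return (hd vs)
      else if r = 0 then State_Monad.return (hd us) else unit_cost (max (hd us) (hd vs))) v0 c0"
    by (simp add: v0_def c0_def runs_return runs_unit_cost[simplified])
  have w: "runs (if s = 0 then State_Monad.return (last vs)
      else if r = 0 then State_Monad.return (last us) else unit_cost (min (last us) (last vs))) w c0"
    by (simp add: w_def c0_def runs_return runs_unit_cost[simplified])
  have "runs (algorithm1 T h C \<alpha> xs ys) (k - 1) (s + (r + (c0 + (c0 + Suc (c + 0)))))"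
    unfolding algorithm1_def Let_def s_def[symmetric] r_def[symmetric]
    by (rule runs_bind[OF us], rule runs_bind[OF vs], rule runs_bind[OF v0], rule runs_bind[OF w],
        rule runs_unit_cost_bind, fold u_def v_def, rule runs_bind[OF loop(1)])
      (simp add: runs_return)
  moreover have "\<not> exceeds a k" for a
    using loop(4)[of a] by (cases "a \<le> s + r") (auto simp: exceeds_def)
  ultimately show thesis
    using loop(2,3,5) by (intro that[of "k - 1"]) (auto simp: exceeds_eq c0_def)
qed

theorem theorem2:
  shows "\<exists>B :: nat \<Rightarrow> nat. (\<lambda>m. real (B m)) \<in> O(\<lambda>m. real m) \<and>
    (\<forall>(m :: nat) (T :: nat \<Rightarrow> real) (D :: real set) (h :: real \<Rightarrow> real)
       (C :: nat \<Rightarrow> real \<Rightarrow> real) (\<alpha> :: real) (S :: nat set).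
      m \<ge> 1 \<longrightarrow> antimono_on {1..m} T \<longrightarrow> T ` {1..m} \<subseteq> D \<longrightarrow> mono_on D h \<longrightarrow> S \<subseteq> {1..m} \<longrightarrow>
      (let run = algorithm1 T h C \<alpha> (sorted_list_of_set S) (sorted_list_of_set ({1..m} - S))
       in result run = false_discovery_bound m (local_test T h C \<alpha>) S \<and> cost run \<le> B m))"
proof (intro exI[of _ "\<lambda>m. 9 * m + 3"] conjI allI impI)
  show "(\<lambda>m. real (9 * m + 3)) \<in> O(\<lambda>m. real m)"
    by (rule bigoI[of _ 12]) (auto intro!: eventually_mono[OF eventually_ge_at_top[of 1]])
next
  fix m :: nat and T :: "nat \<Rightarrow> real" and D :: "real set" and h :: "real \<Rightarrow> real"
    and C :: "nat \<Rightarrow> real \<Rightarrow> real" and \<alpha> :: real and S :: "nat set"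
  assume m: "1 \<le> m" and T: "antimono_on {1..m} T" "T ` {1..m} \<subseteq> D"
    and h: "mono_on D h" and S: "S \<subseteq> {1..m}"
  define xs ys where "xs = sorted_list_of_set S" and "ys = sorted_list_of_set ({1..m} - S)"
  have fin: "finite S" using S finite_subset by blast
  have lists: "set xs = S" "distinct xs" "sorted xs" "set ys = {1..m} - S" "distinct ys" "sorted ys"
    using fin by (simp_all add: xs_def ys_def)
  have len: "length xs + length ys = m"
  proof -
    have "length xs = card S" "length ys = card ({1..m} - S)" by (simp_all add: xs_def ys_def)
    then show ?thesis using card_Diff_subset[OF fin S] card_mono[OF _ S] by simp
  qed
  have anti: "antimono_on {..<length zs} (\<lambda>i. h (T (zs ! i)))"
    if "sorted zs" "set zs \<subseteq> {1..m}" for zs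
  proof (rule monotone_onI)
    fix i j assume ij: "i \<in> {..<length zs}" "j \<in> {..<length zs}" "i \<le> j"
    have x: "zs ! i \<in> {1..m}" "zs ! j \<in> {1..m}"
      using ij that(2) by (meson lessThan_iff nth_mem subsetD)+
    have "zs ! i \<le> zs ! j" using ij that(1) by (auto intro: sorted_nth_mono)
    with x have "T (zs ! j) \<le> T (zs ! i)" using monotone_onD[OF T(1)] by blast
    with x show "h (T (zs ! j)) \<le> h (T (zs ! i))" using T(2) by (intro monotone_onD[OF h]) auto
  qed
  have xs_anti: "antimono_on {..<length xs} (\<lambda>i. h (T (xs ! i)))"
    and ys_anti: "antimono_on {..<length ys} (\<lambda>i. h (T (ys ! i)))"
    using lists S by (auto intro!: anti)
  let ?large = "\<lambda>a k. \<exists>J \<subseteq> {1..m}. card J = a \<and> k \<le> card (J \<inter> S) \<and> C a \<alpha> < (\<Sum>i\<in>J. h (T i))"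
  have large_iff: "?large a k \<longleftrightarrow> (\<exists>p q. k \<le> p \<and> p \<le> length xs \<and> q \<le> length ys \<and> p + q = a \<and>
      C a \<alpha> < (\<Sum>i<p. h (T (xs ! i))) + (\<Sum>i<q. h (T (ys ! i))))" for a k
  proof -
    have "set xs \<union> set ys = {1..m}" using lists S by auto
    then show ?thesis
      using ex_subset_sum_iff[OF lists(2) xs_anti lists(5) ys_anti, of a k "C a \<alpha>"] lists by auto
  qed
  obtain e c where run: "runs (algorithm1 T h C \<alpha> xs ys) e c" "c \<le> 9 * m + 3"
    and attained: "e = 0 \<or> (\<exists>a. ?large a e)" and bound: "\<And>a. \<not> ?large a (Suc e)"
  proof (rule runs_algorithm1[where T = T and h = h and C = C and \<alpha> = \<alpha>
        and xs = xs and ys = ys, OF _ xs_anti ys_anti, folded large_iff])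
    show "1 \<le> length xs + length ys" using m len by simp
  qed (rule that, simp_all only: len)
  have "false_discovery_bound m (local_test T h C \<alpha>) S = e"
  proof (rule false_discovery_bound_eqI)
    show "\<not> local_test T h C \<alpha> {}" by (simp add: local_test_def)
    show "e = 0 \<or> (\<exists>J \<subseteq> {1..m}. \<not> local_test T h C \<alpha> J \<and> e \<le> card (J \<inter> S))"
      using attained by (auto simp: local_test_def not_le)
    fix J assume J: "J \<subseteq> {1..m}" "\<not> local_test T h C \<alpha> J"
    show "card (J \<inter> S) \<le> e"
    proof (cases "J = {}")
      case False
      then have "C (card J) \<alpha> < (\<Sum>i\<in>J. h (T i))" using J by (simp add: local_test_def)
      then show ?thesis using bound[of "card J"] J(1) by (auto simp: not_less_eq_eq)
    qed simp
  qed (rule fin)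
  then show "let run = algorithm1 T h C \<alpha> (sorted_list_of_set S) (sorted_list_of_set ({1..m} - S))
    in result run = false_discovery_bound m (local_test T h C \<alpha>) S \<and> cost run \<le> 9 * m + 3"
    using runs_result_cost[OF run(1)] run(2) by (simp add: xs_def ys_def)
qed

end
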